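(* Fix integers $s \ge 2$ and $t \ge 1$. Then, as $n \to \infty$, \[ \alpha_s(H_{2t}(n)) = \Theta\!\left(\frac{2^n}{n^{t}}\right), \] i.e. there are constants $0<c<C$ depending only on $s$ and $t$ such that $c\,2^n/n^t \le \alpha_s(H_{2t}(n)) \le C\,2^n/n^t$ for all sufficiently large $n$.
   Context: For an integer $r \ge 1$, the $r$-distance graph $H_r(n)$ has vertex set $\{0,1\}^n$, and two vertices $x,y$ are adjacent iff their Hamming distance $d_H(x,y)=|\{i : x_i\ne y_i\}|$ equals exactly $r$. For a graph $G$ and integer $s$, $\alpha_s(G)$ denotes the maximum size of a vertex set $S\subseteq V(G)$ such that the induced subgraph $G[S]$ contains no copy of the complete graph $K_s$. *)

theory Defs
  imports
    Complex_Main
    "HOL-Library.FuncSet"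
    "HOL-Library.Landau_Symbols"
    "Graph_Theory.Graph_Theory"
begin

definition hamming_dist :: "nat \<Rightarrow> (nat \<Rightarrow> nat) \<Rightarrow> (nat \<Rightarrow> nat) \<Rightarrow> nat" where
  "hamming_dist n x y = card {i \<in> {..<n}. x i \<noteq> y i}"

text \<open>
  The cube $\{0,1\}^n$ is the set of extensional functions from \<open>{..<n}\<close> to \<open>{0, 1}\<close>.
  Undirected graphs are symmetric digraphs, as everywhere in \<open>Graph_Theory\<close>.
\<close>

definition distance_graph :: "nat \<Rightarrow> nat \<Rightarrow> (nat \<Rightarrow> nat) pair_pre_digraph" where
  "distance_graph r n =
    \<lparr> pverts = {..<n} \<rightarrow>\<^sub>E {0, 1},
      parcs = {(x, y). x \<in> {..<n} \<rightarrow>\<^sub>E {0, 1} \<and> y \<in> {..<n} \<rightarrow>\<^sub>E {0, 1} \<and> hamming_dist n x y = r} \<rparr>"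

lemma finite_cube: "finite ({..<n::nat} \<rightarrow>\<^sub>E {0, 1::nat})"
  by (intro finite_PiE) auto

lemma hamming_dist_commute: "hamming_dist n x y = hamming_dist n y x"
  unfolding hamming_dist_def by (simp add: eq_commute)

lemma pair_graph_distance_graph:
  assumes "1 \<le> r"
  shows "pair_graph (distance_graph r n)"
proof -
  define V where "V = ({..<n} \<rightarrow>\<^sub>E {0, 1} :: (nat \<Rightarrow> nat) set)"
  define E where "E = {(x, y). x \<in> V \<and> y \<in> V \<and> hamming_dist n x y = r}"
  have G: "distance_graph r n = \<lparr> pverts = V, parcs = E \<rparr>"
    unfolding distance_graph_def V_def E_def ..
  have finV: "finite V"
    unfolding V_def by (rule finite_cube)
  have sub: "E \<subseteq> V \<times> V"
    unfolding E_def by blast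
  have finE: "finite E"
    using sub finV by (meson finite_SigmaI finite_subset)
  have symE: "sym E"
    unfolding E_def sym_def by (simp add: hamming_dist_commute)
  have irr: "fst e \<noteq> snd e" if "e \<in> E" for e
    using that assms unfolding E_def by (cases e) (auto simp: hamming_dist_def)
  show ?thesis
    unfolding G using finV finE sub symE irr
    by unfold_locales (auto simp: symmetric_def)
qed

definition contains_complete :: "nat \<Rightarrow> ('a, 'b) pre_digraph \<Rightarrow> bool" where
  "contains_complete s G \<longleftrightarrow> (\<exists>H. subgraph H G \<and> K\<^bsub>s\<^esub> H)"

text \<open>
  \<open>\<alpha>\<^sub>s(G)\<close>; meaningful for finite \<open>G\<close> and \<open>s \<ge> 1\<close>, where the maximum is over a
  finite nonempty set of numbers.
\<close>

definition clique_free_number :: "nat \<Rightarrow> ('a, 'b) pre_digraph \<Rightarrow> nat" where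
  "clique_free_number s G = Max {card S | S. S \<subseteq> verts G \<and> \<not> contains_complete s (G \<restriction> S)}"

lemma clique_free_number_well_defined:
  assumes "finite (verts G)" "1 \<le> s"
  shows "finite {card S | S. S \<subseteq> verts G \<and> \<not> contains_complete s (G \<restriction> S)}"
    and "{card S | S. S \<subseteq> verts G \<and> \<not> contains_complete s (G \<restriction> S)} \<noteq> {}"
proof -
  show "finite {card S | S. S \<subseteq> verts G \<and> \<not> contains_complete s (G \<restriction> S)}"
    using assms(1) by simp
  have "\<not> contains_complete s (G \<restriction> {})"
    using assms(2) by (auto simp: contains_complete_def subgraph_def complete_digraph_def)
  then show "{card S | S. S \<subseteq> verts G \<and> \<not> contains_complete s (G \<restriction> S)} \<noteq> {}"
    by blast
qed

end

theory Submission
  imports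
    Defs
    "HOL-Algebra.Algebraic_Closure_Type"
    "HOL-Library.Z2"
begin

text \<open>
  Lower bound: the words with a prescribed syndrome for a binary BCH code of designed distance
  \<open>2 * t + 1\<close> have no two members at distance \<open>2 * t\<close>, and by pigeonhole some syndrome is attained
  by at least \<open>2 ^ n / q ^ t\<close> words, where \<open>q \<le> 2 * (n + 1)\<close> is a power of two.

  Upper bound: let \<open>S\<close> be clique-free and fix a large constant \<open>k\<close>. Cut \<open>k * m\<close> of the coordinates
  into \<open>k\<close> blocks of length \<open>m = n div k\<close>. Around each vertex \<open>y\<close>, flipping one coordinate per block
  yields an \<open>m\<close>-ary code \<open>F y\<close> of length \<open>k\<close>, and cube distance \<open>2 * t\<close> corresponds to code distance
  \<open>t\<close>. Averaging over \<open>y\<close>, it suffices that a code without \<open>s\<close> words at pairwise distance \<open>t\<close> has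
  \<open>O(m ^ (k - t))\<close> words. This follows in the style of Furedi's delta-system method: a constant
  fraction of the code is homogeneous, meaning that the difference set of any two words occurs in a large
  star around every word. Then the difference sets are closed under union; if every \<open>t\<close>-set of positions
  contained one, some union would have size exactly \<open>t\<close>, giving a forbidden configuration. So some
  \<open>t\<close>-set contains none, and a word is determined by its other \<open>k - t\<close> coordinates.
\<close>

subsection \<open>Homogeneous codes\<close>

definition diff_set :: "('i \<Rightarrow> 'v) \<Rightarrow> ('i \<Rightarrow> 'v) \<Rightarrow> 'i set" where
  "diff_set x y = {i. x i \<noteq> y i}"

text \<open>The code version of a delta-system: the words agree outside \<open>D\<close> and differ
  pairwise at every position of \<open>D\<close>. A single word is a star for every
  \<open>D\<close>.\<close>

definition star :: "'i set \<Rightarrow> ('i \<Rightarrow> 'v) set \<Rightarrow> bool" where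
  "star D A \<longleftrightarrow> (\<forall>x\<in>A. \<forall>y\<in>A. x \<noteq> y \<longrightarrow> diff_set x y = D)"

definition rich :: "nat \<Rightarrow> 'i set set \<Rightarrow> ('i \<Rightarrow> 'v) set \<Rightarrow> bool" where
  "rich S \<D> G \<longleftrightarrow> (\<forall>p\<in>G. \<forall>D\<in>\<D>. \<exists>A\<subseteq>G. p \<in> A \<and> card A = S \<and> star D A)"

text \<open>If \<open>S\<close> is at least 2 and \<open>G\<close> is nonempty, \<open>\<D>\<close>
  is exactly the set of differences occurring in \<open>G\<close>, and each of them is seen from
  every word.\<close>

definition homogeneous :: "nat \<Rightarrow> 'i set set \<Rightarrow> ('i \<Rightarrow> 'v) set \<Rightarrow> bool" where
  "homogeneous S \<D> G \<longleftrightarrow> rich S \<D> G \<and> (\<forall>x\<in>G. \<forall>y\<in>G. x \<noteq> y \<longrightarrow> diff_set x y \<in> \<D>)"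

lemma diff_set_commute: "diff_set x y = diff_set y x"
  by (auto simp: diff_set_def)

lemma diff_set_self [simp]: "diff_set x x = {}"
  by (simp add: diff_set_def)

lemma diff_set_eq_empty_iff: "diff_set x y = {} \<longleftrightarrow> x = y"
  by (auto simp: diff_set_def)

text \<open>Pick a representative \<open>r x\<close> for each class of words agreeing outside \<open>D\<close>. The words sharing a
  coordinate in \<open>D\<close> with their representative split into \<open>card D\<close> parts without \<open>D\<close>-pairs; the rest
  contains only smaller stars.\<close>
lemma card_le_if_no_star:
  assumes "finite H" "finite D" "D \<noteq> {}"
    and "\<And>A. A \<subseteq> H \<Longrightarrow> card A = S \<Longrightarrow> \<not> star D A"
    and "\<And>P. P \<subseteq> H \<Longrightarrow> (\<forall>x\<in>P. \<forall>y\<in>P. diff_set x y \<noteq> D) \<Longrightarrow> card P \<le> B"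
  shows "card H \<le> S * card D * B"
  using assms
proof (induction S arbitrary: H)
  case 0
  then show ?case by (metis card.empty empty_iff empty_subsetI star_def)
next
  case (Suc S)
  show ?case
  \<comment> \<open>Size one is treated apart: singletons are stars, and the extension of a star
    below needs a nonempty star to start from.\<close>
  proof (cases "S = 0")
    case True
    then have "H = {}"
    proof -
      have "x \<notin> H" for x
        using Suc.prems(4)[of "{x}"] True by (auto simp: star_def)
      then show ?thesis by blast
    qed
    then show ?thesis by simp
  next
    case False
    \<comment> \<open>Choosing from the class as a set makes \<open>r\<close> constant on classes,
      since equal sets give equal choices.\<close>
    define r where "r x = (SOME y. y \<in> {y\<in>H. diff_set x y \<subseteq> D})" for x
    have r: "r x \<in> H \<and> diff_set x (r x) \<subseteq> D" if "x \<in> H" for x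
    proof -
      have "\<exists>y. y \<in> {y\<in>H. diff_set x y \<subseteq> D}"
        using that by (intro exI[of _ x]) simp
      from someI_ex[OF this] show ?thesis unfolding r_def by simp
    qed
    have r_cong: "r x = r y" if "diff_set x y \<subseteq> D" for x y
    proof -
      have "{z\<in>H. diff_set x z \<subseteq> D} = {z\<in>H. diff_set y z \<subseteq> D}"
      proof -
        have "diff_set x z \<subseteq> D \<longleftrightarrow> diff_set y z \<subseteq> D" for z
          using that unfolding diff_set_def by (simp add: subset_eq) metis
        then show ?thesis by simp
      qed
      then show ?thesis unfolding r_def by simp
    qed
    define P where "P d = {x\<in>H. x d = r x d}" for d
    define H' where "H' = {x\<in>H. diff_set x (r x) = D}"
    have cover: "H \<subseteq> (\<Union>d\<in>D. P d) \<union> H'"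
      using r unfolding P_def H'_def diff_set_def by auto
    have cardP: "card (P d) \<le> B" if "d \<in> D" for d
    proof (rule Suc.prems(5))
      show "P d \<subseteq> H" by (auto simp: P_def)
      show "\<forall>x\<in>P d. \<forall>y\<in>P d. diff_set x y \<noteq> D"
      proof (intro ballI notI)
        fix x y assume xy: "x \<in> P d" "y \<in> P d" "diff_set x y = D"
        then have "r x = r y" using r_cong[of x y] by simp
        then have "x d = y d" using xy by (simp add: P_def)
        then show False using xy(3) that by (auto simp: diff_set_def)
      qed
    qed
    \<comment> \<open>Words of a star for \<open>D\<close> in \<open>H'\<close> share their
      representative, which differs from each of them exactly on \<open>D\<close>. Adding it
      enlarges the star by one, so \<open>H'\<close> has no star of size \<open>S\<close>.\<close>
    have "card H' \<le> S * card D * B"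
    proof (rule Suc.IH)
      show "finite H'" using Suc.prems(1) by (auto simp: H'_def)
      show "card Q \<le> B" if "Q \<subseteq> H'" "\<forall>x\<in>Q. \<forall>y\<in>Q. diff_set x y \<noteq> D" for Q
        using Suc.prems(5)[of Q] that by (auto simp: H'_def)
      show "\<not> star D A" if A: "A \<subseteq> H'" "card A = S" for A
      proof
        assume st: "star D A"
        have fin: "finite A" using A(1) \<open>finite H'\<close> finite_subset by blast
        show False
        proof (cases "A = {}")
          case True
          then show False using A(2) \<open>S \<noteq> 0\<close> by simp
        next
          case False
          then obtain a where a: "a \<in> A" by blast
          have ra: "r x = r a" if "x \<in> A" for x
            using that a st r_cong[of x a] by (cases "x = a") (auto simp: star_def)
          have dx: "diff_set x (r a) = D" if "x \<in> A" for x
            using ra[OF that] that A(1) by (auto simp: H'_def)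
          have notin: "r a \<notin> A" using dx Suc.prems(3) by fastforce
          have "star D (insert (r a) A)"
            using st dx by (auto simp: star_def diff_set_commute)
          moreover have "insert (r a) A \<subseteq> H" using A(1) a r by (auto simp: H'_def)
          moreover have "card (insert (r a) A) = Suc S" using notin fin A(2) by simp
          ultimately show False using Suc.prems(4) by blast
        qed
      qed
    qed (use Suc.prems in auto)
    have "card H \<le> card ((\<Union>d\<in>D. P d) \<union> H')"
      using Suc.prems(1,2) by (intro card_mono cover) (auto simp: P_def H'_def)
    also have "\<dots> \<le> card (\<Union>d\<in>D. P d) + card H'" by (rule card_Un_le)
    also have "card (\<Union>d\<in>D. P d) \<le> (\<Sum>d\<in>D. card (P d))"
      by (rule card_UN_le) fact
    also have "\<dots> \<le> card D * B"
      using sum_bounded_above[of D "\<lambda>d. card (P d)" B] cardP by simp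
    finally show ?thesis using \<open>card H' \<le> S * card D * B\<close> by (simp add: algebra_simps)
  qed
qed


text \<open>Greedy removal: while some word \<open>p\<close> lies in no star of size
  \<open>S\<close> for some \<open>D\<close> in \<open>\<D>\<close>, remove it and set
  \<open>\<tau> p = D\<close>. A star of size \<open>S\<close> inside a class of
  \<open>\<tau>\<close> would contradict the removal of its first removed word.\<close>

lemma rich_decomposition:
  assumes "finite F" "0 < S"
  shows "\<exists>G \<tau>. G \<subseteq> F \<and> rich S \<D> G \<and> (\<forall>x\<in>F - G. \<tau> x \<in> \<D>) \<and>
    (\<forall>D A. A \<subseteq> {x\<in>F - G. \<tau> x = D} \<longrightarrow> card A = S \<longrightarrow> \<not> star D A)"
  using assms(1)
proof (induction F rule: finite_psubset_induct)
  case (psubset F)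
  show ?case
  proof (cases "rich S \<D> F")
    case True
    then show ?thesis using assms(2) by (intro exI[of _ F] exI) auto
  next
    case False
    then obtain p D where p: "p \<in> F" "D \<in> \<D>"
      and no: "\<And>A. A \<subseteq> F \<Longrightarrow> p \<in> A \<Longrightarrow> card A = S \<Longrightarrow> \<not> star D A"
      unfolding rich_def by blast
    obtain G \<tau> where G: "G \<subseteq> F - {p}" "rich S \<D> G" "\<forall>x\<in>F - {p} - G. \<tau> x \<in> \<D>"
      and no': "\<And>D A. A \<subseteq> {x\<in>F - {p} - G. \<tau> x = D} \<Longrightarrow> card A = S \<Longrightarrow> \<not> star D A"
      using psubset.IH[of "F - {p}"] p(1) by blast
    have "\<not> star E A" if A: "A \<subseteq> {x\<in>F - G. (\<tau>(p := D)) x = E}" "card A = S" for E A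
    proof (cases "p \<in> A")
      case True
      then have "A \<subseteq> F" "D = E" using A(1) by (auto split: if_splits)
      then show ?thesis using no True A(2) by blast
    next
      case False
      then show ?thesis using A by (intro no') (auto split: if_splits)
    qed
    then show ?thesis using G p
      by (intro exI[of _ G] exI[of _ "\<tau>(p := D)"]) auto
  qed
qed

text \<open>Induction on the number of allowed differences. The rich part is homogeneous; a
  discarded class with label \<open>E\<close> has no large star for \<open>E\<close>, which reduces
  it to subcodes whose differences avoid \<open>E\<close>. Since \<open>N\<close> is quantified
  first, it depends only on \<open>S\<close>, \<open>k\<close> and \<open>a\<close>.\<close>

lemma card_le_if_homogeneous_le:
  fixes k S a :: nat
  assumes S: "0 < S"
  shows "\<exists>N. \<forall>\<D> B (F :: ('i \<Rightarrow> 'v) set). finite F \<longrightarrow> finite \<D> \<longrightarrow> card \<D> = a \<longrightarrow>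
    (\<forall>D\<in>\<D>. finite D \<and> D \<noteq> {} \<and> card D \<le> k) \<longrightarrow>
    (\<forall>x\<in>F. \<forall>y\<in>F. x \<noteq> y \<longrightarrow> diff_set x y \<in> \<D>) \<longrightarrow>
    (\<forall>G \<E>. G \<subseteq> F \<longrightarrow> \<E> \<subseteq> \<D> \<longrightarrow> homogeneous S \<E> G \<longrightarrow> card G \<le> B) \<longrightarrow> card F \<le> N * B"
proof (induction a)
  case 0
  have hom: "homogeneous S {} F"
    if "\<forall>x\<in>F. \<forall>y\<in>F. x \<noteq> y \<longrightarrow> diff_set x y \<in> {}" for F :: "('i \<Rightarrow> 'v) set"
    using that by (simp add: homogeneous_def rich_def)
  show ?case
  proof (intro exI[of _ 1] allI impI)
    fix \<D> :: "'i set set" and B and F :: "('i \<Rightarrow> 'v) set"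
    assume "finite \<D>" "card \<D> = 0" and diff: "\<forall>x\<in>F. \<forall>y\<in>F. x \<noteq> y \<longrightarrow> diff_set x y \<in> \<D>"
      and B: "\<forall>G \<E>. G \<subseteq> F \<longrightarrow> \<E> \<subseteq> \<D> \<longrightarrow> homogeneous S \<E> G \<longrightarrow> card G \<le> B"
    then have "\<D> = {}" by simp
    then have "homogeneous S {} F" using hom diff by blast
    then have "card F \<le> B" using B by blast
    then show "card F \<le> 1 * B" by simp
  qed
next
  case (Suc a)
  define ok where "ok N \<longleftrightarrow> (\<forall>\<D> B (F :: ('i \<Rightarrow> 'v) set). finite F \<longrightarrow> finite \<D> \<longrightarrow> card \<D> = a \<longrightarrow>
    (\<forall>D\<in>\<D>. finite D \<and> D \<noteq> {} \<and> card D \<le> k) \<longrightarrow>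
    (\<forall>x\<in>F. \<forall>y\<in>F. x \<noteq> y \<longrightarrow> diff_set x y \<in> \<D>) \<longrightarrow>
    (\<forall>G \<E>. G \<subseteq> F \<longrightarrow> \<E> \<subseteq> \<D> \<longrightarrow> homogeneous S \<E> G \<longrightarrow> card G \<le> B) \<longrightarrow> card F \<le> N * B)" for N
  have "\<exists>N. ok N" using Suc unfolding ok_def .
  then obtain N where "ok N" ..
  then have N: "card F \<le> N * B" if "finite F" "finite \<D>" "card \<D> = a"
    "\<forall>D\<in>\<D>. finite D \<and> D \<noteq> {} \<and> card D \<le> k"
    "\<forall>x\<in>F. \<forall>y\<in>F. x \<noteq> y \<longrightarrow> diff_set x y \<in> \<D>"
    "\<forall>G \<E>. G \<subseteq> F \<longrightarrow> \<E> \<subseteq> \<D> \<longrightarrow> homogeneous S \<E> G \<longrightarrow> card G \<le> B" for \<D> B and F :: "('i \<Rightarrow> 'v) set"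
    using that unfolding ok_def by simp
  show ?case
  \<comment> \<open>The rich part contributes \<open>B\<close>, each of the \<open>Suc a\<close>
    discarded classes at most \<open>S * k * N * B\<close>.\<close>
  proof (intro exI[of _ "1 + Suc a * (S * k * N)"] allI impI)
    fix \<D> B and F :: "('i \<Rightarrow> 'v) set"
    assume fin: "finite F" "finite \<D>" and card: "card \<D> = Suc a"
      and D: "\<forall>D\<in>\<D>. finite D \<and> D \<noteq> {} \<and> card D \<le> k"
      and diff: "\<forall>x\<in>F. \<forall>y\<in>F. x \<noteq> y \<longrightarrow> diff_set x y \<in> \<D>"
      and B: "\<forall>G \<E>. G \<subseteq> F \<longrightarrow> \<E> \<subseteq> \<D> \<longrightarrow> homogeneous S \<E> G \<longrightarrow> card G \<le> B"
    obtain G \<tau> where G: "G \<subseteq> F" "rich S \<D> G" "\<forall>x\<in>F - G. \<tau> x \<in> \<D>"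
      and no: "\<forall>D A. A \<subseteq> {x\<in>F - G. \<tau> x = D} \<longrightarrow> card A = S \<longrightarrow> \<not> star D A"
      using rich_decomposition[OF fin(1) S, of \<D>] by (elim exE conjE) (rule that)
    define H where "H D = {x\<in>F - G. \<tau> x = D}" for D
    have "homogeneous S \<D> G" using G diff by (auto simp: homogeneous_def)
    then have cardG: "card G \<le> B" using G B by blast
    have cardH: "card (H E) \<le> S * k * N * B" if E: "E \<in> \<D>" for E
    proof -
      have "card (H E) \<le> S * card E * (N * B)"
      proof (rule card_le_if_no_star)
        show "finite (H E)" using fin by (auto simp: H_def)
        show "\<not> star E A" if "A \<subseteq> H E" "card A = S" for A
          using no that by (auto simp: H_def)
        show "card P \<le> N * B" if P: "P \<subseteq> H E" "\<forall>x\<in>P. \<forall>y\<in>P. diff_set x y \<noteq> E" for P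
        proof (rule N[of P "\<D> - {E}"])
          have PF: "P \<subseteq> F" using P by (auto simp: H_def)
          show "finite P" using PF fin finite_subset by blast
          show "finite (\<D> - {E})" "card (\<D> - {E}) = a" using E card fin by auto
          show "\<forall>x\<in>P. \<forall>y\<in>P. x \<noteq> y \<longrightarrow> diff_set x y \<in> \<D> - {E}"
            using P(2) diff subsetD[OF PF] by auto
          show "\<forall>G \<E>. G \<subseteq> P \<longrightarrow> \<E> \<subseteq> \<D> - {E} \<longrightarrow> homogeneous S \<E> G \<longrightarrow> card G \<le> B"
            using B PF by (meson Diff_subset order_trans)
        qed (use D in auto)
      qed (use D E in auto)
      also have "\<dots> \<le> S * k * (N * B)" using D E by (intro mult_le_mono) auto
      finally show ?thesis by (simp add: mult.assoc)
    qed
    have "F \<subseteq> G \<union> (\<Union>E\<in>\<D>. H E)" using G by (auto simp: H_def)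
    then have "card F \<le> card (G \<union> (\<Union>E\<in>\<D>. H E))"
      using fin G finite_subset by (intro card_mono) (auto simp: H_def)
    also have "\<dots> \<le> card G + card (\<Union>E\<in>\<D>. H E)" by (rule card_Un_le)
    also have "card (\<Union>E\<in>\<D>. H E) \<le> (\<Sum>E\<in>\<D>. card (H E))" by (rule card_UN_le) fact
    also have "\<dots> \<le> card \<D> * (S * k * N * B)"
      using sum_bounded_above[of \<D> "\<lambda>E. card (H E)"] cardH by simp
    finally show "card F \<le> (1 + Suc a * (S * k * N)) * B"
      using cardG card by (simp add: algebra_simps)
  qed
qed

subsection \<open>Codes without equidistant words\<close>

text \<open>Fix \<open>p\<close>, a word \<open>q\<close> differing from it on \<open>D\<close>, and
  a star for \<open>E\<close> through \<open>p\<close>. Each \<open>i\<close> in \<open>E\<close>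
  rules out at most one word of the star that agrees with \<open>q\<close> at \<open>i\<close>; with
  \<open>p\<close> itself this excludes at most \<open>card E + 1\<close> words. A remaining
  \<open>z\<close> differs from \<open>q\<close> on all of \<open>E\<close> and agrees with
  \<open>p\<close> elsewhere, so the difference of \<open>q\<close> and \<open>z\<close> is
  \<open>D \<union> E\<close>.\<close>

lemma homogeneous_Un:
  fixes G :: "('i \<Rightarrow> 'v) set"
  assumes G: "homogeneous S \<D> G" "G \<noteq> {}" and D: "D \<in> \<D>" and E: "E \<in> \<D>" "finite E" "E \<noteq> {}"
    and S: "card E + 2 \<le> S"
  shows "D \<union> E \<in> \<D>"
proof -
  obtain p where p: "p \<in> G" using G(2) by blast
  obtain A where A: "A \<subseteq> G" "p \<in> A" "card A = S" "star D A"
    using G(1) p D by (auto simp: homogeneous_def rich_def)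
  obtain A' where A': "A' \<subseteq> G" "p \<in> A'" "card A' = S" "star E A'"
    using G(1) p E by (auto simp: homogeneous_def rich_def)
  have fin: "finite A'" using A'(3) S card.infinite by fastforce
  have "A \<noteq> {p}" using A(3) S by auto
  then obtain q where q: "q \<in> A" "q \<noteq> p" using A(2) by auto
  define bad where "bad i = {z\<in>A'. z i = q i}" for i
  have bad: "card (bad i) \<le> 1" if "i \<in> E" for i
  proof (rule ccontr)
    assume "\<not> card (bad i) \<le> 1"
    then obtain y z where yz: "y \<in> bad i" "z \<in> bad i" "y \<noteq> z"
      by (metis One_nat_def card_le_Suc0_iff_eq card.infinite zero_le)
    then have "diff_set y z = E" using A'(4) by (auto simp: star_def bad_def)
    then show False using yz that by (auto simp: diff_set_def bad_def)
  qed
  have "card (insert p (\<Union>i\<in>E. bad i)) \<le> 1 + card (\<Union>i\<in>E. bad i)"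
    using fin E by (subst card_insert_if) (auto simp: bad_def)
  also have "card (\<Union>i\<in>E. bad i) \<le> (\<Sum>i\<in>E. card (bad i))"
    by (rule card_UN_le) fact
  also have "\<dots> \<le> card E" using sum_bounded_above[of E "\<lambda>i. card (bad i)" 1] bad by simp
  finally have "card (insert p (\<Union>i\<in>E. bad i)) < card A'" using A'(3) S by simp
  moreover have "finite (insert p (\<Union>i\<in>E. bad i))" using fin E by (auto simp: bad_def)
  ultimately have "\<not> A' \<subseteq> insert p (\<Union>i\<in>E. bad i)"
    by (meson card_mono leD)
  then obtain z where z: "z \<in> A'" "z \<noteq> p" "\<And>i. i \<in> E \<Longrightarrow> z i \<noteq> q i" by (auto simp: bad_def)
  have "diff_set p q = D" "diff_set p z = E"
    using A A' q z by (auto simp: star_def)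
  then have "diff_set q z = D \<union> E"
    using z(3) unfolding diff_set_def by (auto simp: set_eq_iff) metis+
  moreover have "q \<noteq> z" using z(3) E(3) by auto
  ultimately show ?thesis
    using G(1) subsetD[OF A(1) q(1)] subsetD[OF A'(1) z(1)] unfolding homogeneous_def by metis
qed

lemma Un_closed_UN:
  assumes "\<And>D E. D \<in> \<D> \<Longrightarrow> E \<in> \<D> \<Longrightarrow> D \<union> E \<in> \<D>"
    and "finite V" "V \<noteq> {}" "\<And>v. v \<in> V \<Longrightarrow> M v \<in> \<D>"
  shows "(\<Union>v\<in>V. M v) \<in> \<D>"
  using assms(2-4) by (induction V rule: finite_ne_induct) (auto intro: assms(1))

text \<open>A maximal set \<open>I\<close> containing no member has fewer than \<open>t\<close> elements, and each \<open>v\<close> outside \<open>I\<close> lies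
  in a member \<open>M v \<subseteq> insert v I\<close>. If many of the \<open>M v\<close> have the same trace \<open>P\<close> on \<open>I\<close>, the union of
  \<open>t - card P\<close> of them has size \<open>t\<close>.\<close>
lemma Un_closed_family_has_card:
  fixes K :: "'i set" and t :: nat
  assumes K: "finite K" "t + t * 2 ^ t \<le> card K" and t: "1 \<le> t"
    and sub: "\<And>D. D \<in> \<D> \<Longrightarrow> D \<subseteq> K \<and> D \<noteq> {}"
    and Un: "\<And>D E. D \<in> \<D> \<Longrightarrow> E \<in> \<D> \<Longrightarrow> D \<union> E \<in> \<D>"
    and cover: "\<And>T. T \<subseteq> K \<Longrightarrow> card T = t \<Longrightarrow> \<exists>D\<in>\<D>. D \<subseteq> T"
  shows "\<exists>D\<in>\<D>. card D = t"
proof -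
  define ind where "ind I \<longleftrightarrow> I \<subseteq> K \<and> (\<forall>D\<in>\<D>. \<not> D \<subseteq> I)" for I
  have "ind {}" using sub by (auto simp: ind_def)
  moreover have "\<forall>I. ind I \<longrightarrow> card I < Suc (card K)"
    using K(1) by (auto simp: ind_def less_Suc_eq_le intro: card_mono)
  ultimately obtain I where I: "ind I" and max: "\<And>J. ind J \<Longrightarrow> card J \<le> card I"
    using ex_has_greatest_nat[of ind "{}" card "Suc (card K)"] by blast
  have finI: "finite I" using I K finite_subset by (auto simp: ind_def)
  have It: "card I < t"
  proof (rule ccontr)
    assume "\<not> card I < t"
    then obtain T where "T \<subseteq> I" "card T = t" by (meson not_less obtain_subset_with_card_n)
    moreover have "T \<subseteq> K" using I \<open>T \<subseteq> I\<close> by (auto simp: ind_def)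
    ultimately show False using cover[of T] I unfolding ind_def by (meson order_trans)
  qed
  have "\<exists>M. M \<in> \<D> \<and> v \<in> M \<and> M \<subseteq> insert v I" if v: "v \<in> K - I" for v
  proof -
    have "\<not> ind (insert v I)" using max[of "insert v I"] v finI by auto
    then obtain M where M: "M \<in> \<D>" "M \<subseteq> insert v I" using v I by (auto simp: ind_def)
    moreover have "v \<in> M" using M I by (auto simp: ind_def)
    ultimately show ?thesis by blast
  qed
  then obtain M where M: "\<And>v. v \<in> K - I \<Longrightarrow> M v \<in> \<D> \<and> v \<in> M v \<and> M v \<subseteq> insert v I" by metis
  define fib where "fib P = {v\<in>K - I. M v \<inter> I = P}" for P
  \<comment> \<open>Pigeonhole over the at most \<open>2 ^ t\<close> traces: as
    \<open>card I < t\<close>, more than \<open>t * 2 ^ t\<close> elements of \<open>K\<close> lie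
    outside \<open>I\<close>.\<close>
  have "\<exists>P\<in>Pow I. t \<le> card (fib P)"
  proof (rule ccontr)
    assume "\<not> ?thesis"
    then have small: "card (fib P) \<le> t" if "P \<in> Pow I" for P
      using that by (meson nat_le_linear)
    have "card (K - I) \<le> card (\<Union>P\<in>Pow I. fib P)"
    proof (rule card_mono)
      show "finite (\<Union>P\<in>Pow I. fib P)" using K(1) finI by (simp add: fib_def)
      show "K - I \<subseteq> (\<Union>P\<in>Pow I. fib P)"
      proof
        fix v assume "v \<in> K - I"
        then have "v \<in> fib (M v \<inter> I)" by (simp add: fib_def)
        then show "v \<in> (\<Union>P\<in>Pow I. fib P)" by (intro UN_I[of "M v \<inter> I"]) simp
      qed
    qed
    also have "\<dots> \<le> (\<Sum>P\<in>Pow I. card (fib P))" using finI by (intro card_UN_le) auto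
    also have "\<dots> \<le> card (Pow I) * t"
      using sum_bounded_above[of "Pow I" "\<lambda>P. card (fib P)" t] small by simp
    also have "\<dots> \<le> 2 ^ t * t"
      using It finI by (simp add: card_Pow)
    finally have "card (K - I) \<le> t * 2 ^ t" by (simp add: mult.commute)
    moreover have "card (K - I) = card K - card I"
      using I finI by (intro card_Diff_subset) (auto simp: ind_def)
    ultimately show False using K It by linarith
  qed
  then obtain P where P: "P \<subseteq> I" "t \<le> card (fib P)" by blast
  then have "t - card P \<le> card (fib P)" by simp
  then obtain V where V: "V \<subseteq> fib P" "card V = t - card P" "finite V"
    by (meson obtain_subset_with_card_n)
  have cP: "card P < t" using P finI It card_mono[of I P] by simp
  then have "V \<noteq> {}" using V by auto
  have "M v = insert v P" if "v \<in> V" for v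
    using that V M[of v] by (auto simp: fib_def)
  then have "(\<Union>v\<in>V. M v) = V \<union> P" using \<open>V \<noteq> {}\<close> by auto
  moreover have "(\<Union>v\<in>V. M v) \<in> \<D>"
    using V M \<open>V \<noteq> {}\<close> by (intro Un_closed_UN Un) (auto simp: fib_def)
  moreover have "card (V \<union> P) = t"
  proof -
    have "V \<inter> P = {}" using V P by (auto simp: fib_def)
    then show ?thesis using V cP P finI finite_subset by (subst card_Un_disjoint) auto
  qed
  ultimately show ?thesis by metis
qed

text \<open>The reduction to homogeneous subcodes costs the factor \<open>N\<close>, and each such
  subcode has at most \<open>m ^ (k - t)\<close> words. It matters that \<open>N\<close> does not
  depend on \<open>m\<close>, which later grows with \<open>n\<close>.\<close>

lemma card_code_le:
  fixes k s t :: nat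
  assumes t: "1 \<le> t" and k: "k = t + t * 2 ^ t"
  shows "\<exists>N. \<forall>m (F :: (nat \<Rightarrow> nat) set). F \<subseteq> {..<k} \<rightarrow>\<^sub>E {..<m} \<longrightarrow>
    (\<forall>A\<subseteq>F. card A = s \<longrightarrow> (\<exists>x\<in>A. \<exists>y\<in>A. x \<noteq> y \<and> card (diff_set x y) \<noteq> t)) \<longrightarrow>
    card F \<le> N * m ^ (k - t)"
proof -
  \<comment> \<open>The part \<open>k + 2\<close> serves closure under union, as differences have at
    most \<open>k\<close> elements; \<open>s\<close> lets a star contain a forbidden set of
    \<open>s\<close> words.\<close>
  define S where "S = s + k + 2"
  define \<D> where "\<D> = Pow {..<k} - {{}}"
  define ok where "ok N \<longleftrightarrow> (\<forall>\<D> B (F :: (nat \<Rightarrow> nat) set). finite F \<longrightarrow> finite \<D> \<longrightarrow> card \<D> = card (Pow {..<k} - {{}}) \<longrightarrow>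
    (\<forall>D\<in>\<D>. finite D \<and> D \<noteq> {} \<and> card D \<le> k) \<longrightarrow>
    (\<forall>x\<in>F. \<forall>y\<in>F. x \<noteq> y \<longrightarrow> diff_set x y \<in> \<D>) \<longrightarrow>
    (\<forall>G \<E>. G \<subseteq> F \<longrightarrow> \<E> \<subseteq> \<D> \<longrightarrow> homogeneous S \<E> G \<longrightarrow> card G \<le> B) \<longrightarrow> card F \<le> N * B)" for N
  have "0 < S" by (simp add: S_def)
  then have "\<exists>N. ok N" unfolding ok_def by (rule card_le_if_homogeneous_le)
  then obtain N where N: "ok N" ..
  show ?thesis
  proof (intro exI[of _ N] allI impI)
    fix m and F :: "(nat \<Rightarrow> nat) set"
    assume F: "F \<subseteq> {..<k} \<rightarrow>\<^sub>E {..<m}"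
      and free: "\<forall>A\<subseteq>F. card A = s \<longrightarrow> (\<exists>x\<in>A. \<exists>y\<in>A. x \<noteq> y \<and> card (diff_set x y) \<noteq> t)"
    have "finite ({..<k} \<rightarrow>\<^sub>E {..<m})" by (intro finite_PiE) auto
    then have finF: "finite F" using F finite_subset by blast
    have finD: "finite \<D>" by (simp add: \<D>_def)
    have D: "finite D \<and> D \<noteq> {} \<and> card D \<le> k" if "D \<in> \<D>" for D
    proof -
      have "D \<subseteq> {..<k}" "D \<noteq> {}" using that by (auto simp: \<D>_def)
      then show ?thesis using card_mono[of "{..<k}" D] finite_subset by fastforce
    qed
    have diff: "diff_set x y \<in> \<D>" if "x \<in> F" "y \<in> F" "x \<noteq> y" for x y
    proof -
      have "x \<in> {..<k} \<rightarrow>\<^sub>E {..<m}" "y \<in> {..<k} \<rightarrow>\<^sub>E {..<m}" using that F by auto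
      then have "x i = y i" if "i \<notin> {..<k}" for i using that by (metis PiE_arb)
      then have "diff_set x y \<subseteq> {..<k}" unfolding diff_set_def by blast
      then show ?thesis using that diff_set_eq_empty_iff[of x y] by (simp add: \<D>_def)
    qed
    have hom: "card G \<le> m ^ (k - t)" if G: "G \<subseteq> F" and E: "\<E> \<subseteq> \<D>" and h: "homogeneous S \<E> G" for G \<E>
    proof (cases "G = {}")
      case False
      have "\<exists>T. T \<subseteq> {..<k} \<and> card T = t \<and> (\<forall>D\<in>\<E>. \<not> D \<subseteq> T)"
      proof (rule ccontr)
        assume cov: "\<not> ?thesis"
        have "\<exists>D\<in>\<E>. card D = t"
        proof (rule Un_closed_family_has_card[of "{..<k}"])
          show "D \<union> D' \<in> \<E>" if "D \<in> \<E>" "D' \<in> \<E>" for D D'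
          proof (rule homogeneous_Un[OF h False])
            show "card D' + 2 \<le> S" "finite D'" "D' \<noteq> {}"
              using D[of D'] that E by (auto simp: S_def)
          qed (use that in auto)
          show "\<exists>D\<in>\<E>. D \<subseteq> T" if "T \<subseteq> {..<k}" "card T = t" for T
            using cov that by blast
          show "D \<subseteq> {..<k} \<and> D \<noteq> {}" if "D \<in> \<E>" for D using that E by (auto simp: \<D>_def)
        qed (use t k in auto)
        then obtain D where D: "D \<in> \<E>" "card D = t" by blast
        obtain p where "p \<in> G" using False by blast
        then obtain A where A: "A \<subseteq> G" "card A = S" "star D A"
          using h D by (auto simp: homogeneous_def rich_def)
        then obtain A' where A': "A' \<subseteq> A" "card A' = s"
          by (metis S_def add.assoc le_add1 obtain_subset_with_card_n)
        have "A' \<subseteq> F" using A A' G by blast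
        then show False using free A' A D unfolding star_def by (metis subsetD)
      qed
      then obtain T where T: "T \<subseteq> {..<k}" "card T = t" "\<And>D. D \<in> \<E> \<Longrightarrow> \<not> D \<subseteq> T" by blast
      \<comment> \<open>Distinct words agreeing off \<open>T\<close> would have their difference
        inside \<open>T\<close>, which contains no member of \<open>\<E>\<close>.\<close>
      have "inj_on (\<lambda>x. restrict x ({..<k} - T)) G"
      proof (rule inj_onI, rule ccontr)
        fix x y assume xy: "x \<in> G" "y \<in> G" "restrict x ({..<k} - T) = restrict y ({..<k} - T)" "x \<noteq> y"
        have "diff_set x y \<in> \<E>" using h xy by (auto simp: homogeneous_def)
        moreover have "diff_set x y \<subseteq> {..<k}" using diff[of x y] xy G by (auto simp: \<D>_def)
        then have "diff_set x y \<subseteq> T" using xy(3) unfolding diff_set_def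
          by (auto simp: restrict_def fun_eq_iff subset_eq) metis
        ultimately show False using T by blast
      qed
      moreover have "(\<lambda>x. restrict x ({..<k} - T)) ` G \<subseteq> ({..<k} - T) \<rightarrow>\<^sub>E {..<m}"
        using G F by (force simp: PiE_iff)
      ultimately have "card G \<le> card (({..<k} - T) \<rightarrow>\<^sub>E {..<m})"
        by (intro card_inj_on_le finite_PiE) auto
      also have "\<dots> = m ^ card ({..<k} - T)" by (simp add: card_PiE)
      also have "card ({..<k} - T) = k - t"
        using T by (subst card_Diff_subset) (auto intro: finite_subset)
      finally show ?thesis .
    qed simp
    show "card F \<le> N * m ^ (k - t)"
    proof (rule N[unfolded ok_def, rule_format, of F \<D>])
      show "card \<D> = card (Pow {..<k} - {{}})" by (simp add: \<D>_def)
      show "finite F" "finite \<D>" by fact+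
      show "finite D \<and> D \<noteq> {} \<and> card D \<le> k" if "D \<in> \<D>" for D using D[OF that] .
      show "diff_set x y \<in> \<D>" if "x \<in> F" "y \<in> F" "x \<noteq> y" for x y using diff[OF that] .
      show "card G \<le> m ^ (k - t)" if "G \<subseteq> F" "\<E> \<subseteq> \<D>" "homogeneous S \<E> G" for G \<E> using hom[OF that] .
    qed
  qed
qed

subsection \<open>BCH codes\<close>

text \<open>Over an algebraically closed field \<open>p\<close> splits into linear factors, and a
  repeated factor would give a common root of \<open>p\<close> and its derivative.\<close>

lemma card_roots_eq_degree:
  fixes p :: "'a :: alg_closed_field poly"
  assumes "p \<noteq> 0" and sep: "\<And>a. poly p a = 0 \<Longrightarrow> poly (pderiv p) a \<noteq> 0"
  shows "card {x. poly p x = 0} = degree p"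
proof -
  define c where "c = lead_coeff p"
  obtain A where A: "size A = degree p" "p = smult c (\<Prod>x\<in>#A. [:-x, 1:])"
    using alg_closed_imp_factorization[OF assms(1)] unfolding c_def by blast
  have roots: "poly p x = 0 \<longleftrightarrow> x \<in># A" for x
  proof -
    have "poly p x = c * (\<Prod>y\<in>#A. x - y)"
      by (subst A(2)) (simp add: poly_prod_mset image_mset.compositionality o_def)
    then show ?thesis using assms(1) by (auto simp: c_def)
  qed
  have "count A a \<le> 1" for a
  proof (rule ccontr)
    assume "\<not> count A a \<le> 1"
    then have "replicate_mset 2 a \<subseteq># A" by (simp flip: count_le_replicate_mset_subset_eq)
    then obtain A' where "A = replicate_mset 2 a + A'" by (metis subset_mset.le_iff_add)
    then have "A = add_mset a (add_mset a A')" by (simp add: numeral_2_eq_2)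
    then have "(\<Prod>x\<in>#A. [:-x, 1:]) = [:-a, 1:] * ([:-a, 1:] * (\<Prod>x\<in>#A'. [:-x, 1:]))" by simp
    then have "p = [:-a, 1:] * ([:-a, 1:] * smult c (\<Prod>x\<in>#A'. [:-x, 1:]))"
      by (subst A(2)) (simp only: mult_smult_right)
    then obtain r where "p = [:-a, 1:] * ([:-a, 1:] * r)" by blast
    then have "poly p a = 0" "poly (pderiv p) a = 0" by (simp_all only: pderiv_mult poly_mult poly_add) simp_all
    then show False using sep by blast
  qed
  then have "A = mset_set (set_mset A)"
    by (intro multiset_eqI)
      (metis count_greater_eq_one_iff count_mset_set(1,3) finite_set_mset le_antisym not_in_iff)
  then have "size A = card (set_mset A)" by (metis size_mset_set)
  moreover have "set_mset A = {x. poly p x = 0}" using roots by auto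
  ultimately show ?thesis using A(1) by simp
qed

lemma CHAR_bit [simp]: "CHAR(bit) = 2"
proof (rule CHAR_eqI)
  show "of_nat 2 = (0 :: bit)" by simp
  show "2 dvd n" if "of_nat n = (0 :: bit)" for n using that by (metis dvd_0_right even_of_nat)
qed

text \<open>The polynomial \<open>X ^ (2 ^ m) - X\<close> has derivative \<open>-1\<close> in
  characteristic 2, hence only simple roots.\<close>

lemma card_frobenius_fixed_points:
  assumes "CHAR('a :: alg_closed_field) = 2" "0 < m"
  shows "card {x :: 'a. x ^ (2 ^ m) = x} = 2 ^ m"
proof -
  define p :: "'a poly" where "p = monom 1 (2 ^ m) - monom 1 1"
  have m: "(1::nat) < 2 ^ m" using assms(2) by (intro one_less_power) simp_all
  have "of_nat (2 ^ m) = (0 :: 'a)"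
    using assms by (simp only: of_nat_eq_0_iff_char_dvd) simp
  then have "pderiv p = -1"
    by (simp add: p_def pderiv_diff pderiv_monom)
  have deg: "degree p = 2 ^ m"
    using m unfolding p_def diff_conv_add_uminus by (subst degree_add_eq_left) (auto simp: degree_monom_eq)
  then have "p \<noteq> 0" using m by auto
  then have "card {x. poly p x = 0} = degree p"
    using \<open>pderiv p = -1\<close> by (intro card_roots_eq_degree) simp_all
  then show ?thesis using deg by (simp add: p_def poly_monom)
qed

text \<open>Squaring is additive, so the even power sums vanish along with the odd ones; hence
  \<open>f \<mapsto> \<Sum>a\<in>D. f a\<close> kills all polynomials without constant term of degree at most \<open>2 * t\<close>.\<close>
lemma odd_power_sums_nonzero:
  fixes D :: "'a :: field set"
  assumes char: "CHAR('a) = 2" and D: "finite D" "D \<noteq> {}" "0 \<notin> D" "card D \<le> 2 * t"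
  shows "\<exists>k\<in>{1..t}. (\<Sum>a\<in>D. a ^ (2 * k - 1)) \<noteq> 0"
proof (rule ccontr)
  assume "\<not> ?thesis"
  then have odd0: "(\<Sum>a\<in>D. a ^ (2 * k - 1)) = 0" if "k \<in> {1..t}" for k using that by blast
  have sum0: "(\<Sum>a\<in>D. a ^ j) = 0" if "1 \<le> j" "j \<le> 2 * t" for j
    using that
  proof (induction j rule: less_induct)
    case (less j)
    show ?case
    proof (cases "even j")
      case True
      then obtain i where i: "j = 2 * i" by blast
      have "(\<Sum>a\<in>D. a ^ j) = (\<Sum>a\<in>D. (a ^ i) ^ 2)" by (simp add: i mult.commute flip: power_mult)
      also have "\<dots> = (\<Sum>a\<in>D. a ^ i) ^ 2"
        using char by (intro freshmans_dream_sum[symmetric]) simp_all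
      also have "(\<Sum>a\<in>D. a ^ i) = 0" using less.prems i by (intro less.IH) auto
      finally show ?thesis by simp
    next
      case False
      then obtain i where "j = 2 * i + 1" by (rule oddE)
      then show ?thesis using odd0[of "i + 1"] less.prems by simp
    qed
  qed
  obtain c where c: "c \<in> D" using D by blast
  \<comment> \<open>This polynomial has no constant term, has degree \<open>card D\<close>, and
    vanishes on \<open>D\<close> except at \<open>c\<close>, where \<open>0 \<notin> D\<close> keeps
    it nonzero.\<close>
  define f where "f = [:0, 1:] * (\<Prod>b\<in>D - {c}. [:-b, 1:])"
  have "degree (\<Prod>b\<in>D - {c}. [:-b, 1:]) = card (D - {c})"
    by (subst degree_prod_eq_sum_degree) auto
  moreover have "(\<Prod>b\<in>D - {c}. [:-b, 1:]) \<noteq> 0" using D by simp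
  ultimately have "degree f = 1 + card (D - {c})"
    unfolding f_def by (subst degree_mult_eq) auto
  also have "\<dots> = card D" using c D card_gt_0_iff[of D] by (auto simp: card_Diff_singleton)
  finally have deg: "degree f \<le> 2 * t" using D by simp
  have "(\<Sum>a\<in>D. poly f a) = (\<Sum>a\<in>D. \<Sum>j\<le>degree f. coeff f j * a ^ j)"
    by (simp add: poly_altdef)
  also have "\<dots> = (\<Sum>j\<le>degree f. coeff f j * (\<Sum>a\<in>D. a ^ j))"
    by (subst sum.swap) (simp add: sum_distrib_left)
  also have "\<dots> = 0"
  proof (intro sum.neutral ballI)
    fix j assume "j \<in> {..degree f}"
    then show "coeff f j * (\<Sum>a\<in>D. a ^ j) = 0"
      using sum0[of j] deg by (cases "j = 0") (auto simp: f_def)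
  qed
  finally have "(\<Sum>a\<in>D. poly f a) = 0" .
  moreover have "(\<Sum>a\<in>D. poly f a) = poly f c"
  proof -
    have "poly f a = 0" if "a \<in> D - {c}" for a
    proof -
      have "(\<Prod>b\<in>D - {c}. a - b) = 0" using that D(1) by (intro prod_zero) auto
      then show ?thesis by (simp add: f_def poly_prod)
    qed
    then show ?thesis using c D(1) by (simp add: sum.remove)
  qed
  moreover have "poly f c \<noteq> 0"
    using D(1,3) c by (auto simp: f_def poly_prod)
  ultimately show False by simp
qed

text \<open>Supplies a field order with at least \<open>n\<close> nonzero elements that is still
  linear in \<open>n\<close>.\<close>

lemma exists_power_of_two_between: "\<exists>m>0. n + 1 \<le> 2 ^ m \<and> 2 ^ m \<le> 2 * (n + 1 :: nat)"
proof (induction n)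
  case (Suc n)
  then obtain m where m: "0 < m" "n + 1 \<le> 2 ^ m" "2 ^ m \<le> 2 * (n + 1)" by blast
  show ?case
  proof (cases "Suc n + 1 \<le> 2 ^ m")
    case True
    then show ?thesis using m by (intro exI[of _ m]) auto
  next
    case False
    then show ?thesis using m by (intro exI[of _ "Suc m"]) auto
  qed
qed (auto intro: exI[of _ 1])

lemma pigeonhole_card:
  assumes "finite A" "finite B" "f ` A \<subseteq> B" "B \<noteq> {}"
  shows "\<exists>b\<in>B. card A \<le> card B * card {a\<in>A. f a = b}"
proof (rule ccontr)
  assume neg: "\<not> ?thesis"
  have "(\<Union>b\<in>B. {a\<in>A. f a = b}) = A" using assms(3) by blast
  then have "card A \<le> (\<Sum>b\<in>B. card {a\<in>A. f a = b})"
    using card_UN_le[OF assms(2), of "\<lambda>b. {a\<in>A. f a = b}"] by simp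
  then have "card B * card A \<le> card B * (\<Sum>b\<in>B. card {a\<in>A. f a = b})"
    by (rule mult_le_mono2)
  also have "\<dots> = (\<Sum>b\<in>B. card B * card {a\<in>A. f a = b})" by (rule sum_distrib_left)
  also have "\<dots> < (\<Sum>b\<in>B. card A)"
    using neg assms(2,4) by (intro sum_strict_mono) (auto simp: not_le)
  finally show False by simp
qed

subsection \<open>Cliques in the distance graph\<close>

text \<open>Replaces subgraphs by sets of pairwise equidistant words, the form used in both
  bounds.\<close>

lemma contains_complete_distance_graph_iff:
  assumes S: "S \<subseteq> {..<n} \<rightarrow>\<^sub>E {0, 1}"
  shows "contains_complete s (with_proj (distance_graph r n) \<restriction> S) \<longleftrightarrow>
    (\<exists>A\<subseteq>S. card A = s \<and> (\<forall>x\<in>A. \<forall>y\<in>A. x \<noteq> y \<longrightarrow> hamming_dist n x y = r))"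
    (is "contains_complete s ?G \<longleftrightarrow> ?R")
proof
  assume "contains_complete s ?G"
  then obtain H where H: "subgraph H ?G" "K\<^bsub>s\<^esub> H" by (auto simp: contains_complete_def)
  have "hamming_dist n x y = r" if "x \<in> verts H" "y \<in> verts H" "x \<noteq> y" for x y
  proof -
    have "(x, y) \<in> arcs_ends H" using H(2) that by (simp add: complete_digraph_def)
    then obtain e where "e \<in> arcs H" "tail H e = x" "head H e = y"
      by (auto simp: arcs_ends_def arc_to_ends_def)
    \<comment> \<open>Compatibility forces the endpoint maps of \<open>H\<close> to be the
      projections, so an arc from \<open>x\<close> to \<open>y\<close> is the pair itself.\<close>
    moreover have "arcs H \<subseteq> arcs ?G" and "compatible ?G H"
      using H(1) unfolding subgraph_def by blast+
    moreover have "tail H = fst" "head H = snd"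
      using \<open>compatible ?G H\<close> unfolding compatible_def by simp_all
    ultimately have "(x, y) \<in> arcs ?G" by (cases e) auto
    then show ?thesis by (simp add: distance_graph_def)
  qed
  moreover have "verts H \<subseteq> S" using H(1) by (auto simp: subgraph_def)
  moreover have "card (verts H) = s" using H(2) by (simp add: complete_digraph_def)
  ultimately show ?R by blast
next
  assume ?R
  then obtain A where A: "A \<subseteq> S" "card A = s"
    "\<forall>x\<in>A. \<forall>y\<in>A. x \<noteq> y \<longrightarrow> hamming_dist n x y = r" by blast
  define H :: "(nat \<Rightarrow> nat) pair_pre_digraph"
    where "H = \<lparr>pverts = A, parcs = {(u, v). (u, v) \<in> A \<times> A \<and> u \<noteq> v}\<rparr>"
  have "finite A" by (rule finite_subset[OF subset_trans[OF A(1) S] finite_cube])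
  then have "K\<^bsub>s\<^esub> (with_proj H)" by (simp add: complete_digraph_pair_def H_def A(2))
  moreover have "subgraph (with_proj H) ?G"
    unfolding subgraph_def
  proof (intro conjI)
    show "verts (with_proj H) \<subseteq> verts ?G" using A(1) by (simp add: H_def)
    show "arcs (with_proj H) \<subseteq> arcs ?G"
    proof
      fix e assume "e \<in> arcs (with_proj H)"
      then obtain u v where e: "e = (u, v)" "u \<in> A" "v \<in> A" "u \<noteq> v" by (auto simp: H_def)
      have "u \<in> S" "v \<in> S" using e A(1) by blast+
      then have "u \<in> {..<n} \<rightarrow>\<^sub>E {0, 1}" "v \<in> {..<n} \<rightarrow>\<^sub>E {0, 1}" using S by blast+
      then show "e \<in> arcs ?G"
        using e(1,4) A(3) e(2,3) \<open>u \<in> S\<close> \<open>v \<in> S\<close> by (simp add: distance_graph_def)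
    qed
    show "wf_digraph ?G" by unfold_locales auto
    show "wf_digraph (with_proj H)" by unfold_locales (auto simp: H_def)
    show "compatible ?G (with_proj H)" by (simp add: compatible_def)
  qed
  ultimately show "contains_complete s ?G" by (auto simp: contains_complete_def)
qed

text \<open>Complementation of the coordinates in \<open>P\<close>, meaningful for values 0 and 1.
  Outside \<open>{..<n}\<close> words are \<open>undefined\<close>, so \<open>P\<close> has to stay
  inside that range.\<close>

definition flip :: "nat set \<Rightarrow> (nat \<Rightarrow> nat) \<Rightarrow> nat \<Rightarrow> nat" where
  "flip P y i = (if i \<in> P then 1 - y i else y i)"

lemma flip_in_cube:
  assumes "y \<in> {..<n} \<rightarrow>\<^sub>E {0, 1}" "P \<subseteq> {..<n}"
  shows "flip P y \<in> {..<n} \<rightarrow>\<^sub>E {0, 1}"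
proof (rule PiE_I)
  fix i
  show "i \<in> {..<n} \<Longrightarrow> flip P y i \<in> {0, 1}"
    using PiE_mem[OF assms(1), of i] by (auto simp: flip_def)
  show "i \<notin> {..<n} \<Longrightarrow> flip P y i = undefined"
    using PiE_arb[OF assms(1), of i] assms(2) by (auto simp: flip_def)
qed

lemma flip_flip:
  assumes "y \<in> {..<n} \<rightarrow>\<^sub>E {0, 1}" "P \<subseteq> {..<n}"
  shows "flip P (flip P y) = y"
proof
  fix i
  have "y i \<in> {0, 1}" if "i \<in> P" using PiE_mem[OF assms(1), of i] assms(2) that by blast
  then show "flip P (flip P y) i = y i" by (auto simp: flip_def)
qed

lemma hamming_dist_flip:
  assumes "y \<in> {..<n} \<rightarrow>\<^sub>E {0, 1}" "P \<subseteq> {..<n}" "Q \<subseteq> {..<n}"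
  shows "hamming_dist n (flip P y) (flip Q y) = card ((P - Q) \<union> (Q - P))"
proof -
  have "flip P y i \<noteq> flip Q y i \<longleftrightarrow> i \<in> (P - Q) \<union> (Q - P)" if "i \<in> {..<n}" for i
    using PiE_mem[OF assms(1) that] by (auto simp: flip_def)
  then have "{i\<in>{..<n}. flip P y i \<noteq> flip Q y i} = (P - Q) \<union> (Q - P)"
    using assms(2,3) by blast
  then show ?thesis by (simp add: hamming_dist_def)
qed

text \<open>A word over \<open>{..<m}\<close> of length \<open>k\<close> selects one coordinate in each of \<open>k\<close> consecutive
  blocks of length \<open>m\<close>.\<close>
definition selection :: "nat \<Rightarrow> nat \<Rightarrow> (nat \<Rightarrow> nat) \<Rightarrow> nat set" where
  "selection m k f = (\<lambda>j. j * m + f j) ` {..<k}"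

lemma block_index_eq_iff:
  fixes m :: nat
  assumes "u < m" "v < m"
  shows "i * m + u = j * m + v \<longleftrightarrow> i = j \<and> u = v"
proof
  assume eq: "i * m + u = j * m + v"
  have "(i * m + u) div m = i" "(j * m + v) div m = j" using assms by simp_all
  then show "i = j \<and> u = v" using eq by simp
qed simp

lemma selection_subset:
  assumes "f \<in> {..<k} \<rightarrow>\<^sub>E {..<m}" "k * m \<le> n"
  shows "selection m k f \<subseteq> {..<n}"
proof
  fix i assume "i \<in> selection m k f"
  then obtain j where j: "j < k" "i = j * m + f j" by (auto simp: selection_def)
  have "f j < m" using PiE_mem[OF assms(1), of j] j(1) by simp
  then have "i < Suc j * m" using j(2) by simp
  also have "\<dots> \<le> k * m" using j(1) by (intro mult_right_mono) auto
  finally show "i \<in> {..<n}" using assms(2) by simp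
qed

text \<open>A block where \<open>f\<close> and \<open>g\<close> disagree contributes one coordinate
  from each, a block where they agree none. This turns cube distance \<open>2 * t\<close> into code
  distance \<open>t\<close>.\<close>

lemma card_selection_sym_diff:
  assumes f: "f \<in> {..<k} \<rightarrow>\<^sub>E {..<m}" and g: "g \<in> {..<k} \<rightarrow>\<^sub>E {..<m}"
  shows "card ((selection m k f - selection m k g) \<union> (selection m k g - selection m k f)) =
    2 * card (diff_set f g)"
proof -
  have diff: "selection m k f - selection m k g = (\<lambda>j. j * m + f j) ` diff_set f g"
    and card: "card (selection m k f - selection m k g) = card (diff_set f g)"
    if f: "f \<in> {..<k} \<rightarrow>\<^sub>E {..<m}" and g: "g \<in> {..<k} \<rightarrow>\<^sub>E {..<m}" for f g
  proof -
    have lt: "f j < m" "g j < m" if "j < k" for j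
      using PiE_mem[OF f, of j] PiE_mem[OF g, of j] that by auto
    have sub: "diff_set f g \<subseteq> {..<k}"
    proof -
      have "f j = g j" if "j \<notin> {..<k}" for j using PiE_arb[OF f that] PiE_arb[OF g that] by simp
      then show ?thesis unfolding diff_set_def by blast
    qed
    show diff: "selection m k f - selection m k g = (\<lambda>j. j * m + f j) ` diff_set f g"
    proof (rule Set.set_eqI, rule iffI)
      fix i assume "i \<in> selection m k f - selection m k g"
      then obtain j where "j < k" "i = j * m + f j" "i \<notin> selection m k g"
        by (auto simp: selection_def)
      then show "i \<in> (\<lambda>j. j * m + f j) ` diff_set f g"
        by (auto simp: selection_def diff_set_def)
    next
      fix i assume "i \<in> (\<lambda>j. j * m + f j) ` diff_set f g"
      then obtain j where j: "j \<in> diff_set f g" "i = j * m + f j" by blast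
      then have jk: "j < k" using sub by auto
      have "i \<noteq> j' * m + g j'" if "j' < k" for j'
        using j lt[OF jk] lt[OF that] by (auto simp: block_index_eq_iff diff_set_def)
      then show "i \<in> selection m k f - selection m k g"
        using j jk by (auto simp: selection_def)
    qed
    have "inj_on (\<lambda>j. j * m + f j) (diff_set f g)"
    proof (rule inj_onI)
      fix i j assume ij: "i \<in> diff_set f g" "j \<in> diff_set f g" "i * m + f i = j * m + f j"
      then have "i < k" "j < k" using sub by auto
      then show "i = j" using ij(3) lt by (simp add: block_index_eq_iff)
    qed
    then show "card (selection m k f - selection m k g) = card (diff_set f g)"
      by (simp add: diff card_image)
  qed
  have "finite (selection m k f)" "finite (selection m k g)" by (simp_all add: selection_def)
  then have "card ((selection m k f - selection m k g) \<union> (selection m k g - selection m k f)) =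
    card (selection m k f - selection m k g) + card (selection m k g - selection m k f)"
    by (intro card_Un_disjoint) auto
  then show ?thesis using card[OF f g] card[OF g f] by (simp add: diff_set_commute)
qed

theorem theorem1p4:
  fixes s t :: nat
  assumes "s \<ge> 2" and "t \<ge> 1"
  shows "(\<lambda>n. real (clique_free_number s (with_proj (distance_graph (2 * t) n))))
           \<in> \<Theta>(\<lambda>n. 2 ^ n / real n ^ t)"
proof -
  have t: "1 \<le> t" using assms(2) .

  \<comment> \<open>Upper bound: averaging the code bound over the cube\<close>
  have clique_free_upper_bound: "\<exists>c n\<^sub>0. \<forall>n\<ge>n\<^sub>0. \<forall>S \<subseteq> {..<n} \<rightarrow>\<^sub>E {0, 1}.
    (\<forall>A\<subseteq>S. card A = s \<longrightarrow> (\<exists>x\<in>A. \<exists>y\<in>A. x \<noteq> y \<and> hamming_dist n x y \<noteq> 2 * t)) \<longrightarrow>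
    n ^ t * card S \<le> c * 2 ^ n"
  proof -
    define k where "k = t + t * 2 ^ t"
    have k: "1 \<le> k" "t \<le> k" using t by (auto simp: k_def)
    obtain N where "\<forall>m (F :: (nat \<Rightarrow> nat) set). F \<subseteq> {..<k} \<rightarrow>\<^sub>E {..<m} \<longrightarrow>
      (\<forall>A\<subseteq>F. card A = s \<longrightarrow> (\<exists>x\<in>A. \<exists>y\<in>A. x \<noteq> y \<and> card (diff_set x y) \<noteq> t)) \<longrightarrow>
      card F \<le> N * m ^ (k - t)"
      using card_code_le[OF t k_def, of s] by (elim exE) (rule that)
    note N = this[THEN spec, THEN spec, THEN mp, THEN mp]
    show ?thesis
    \<comment> \<open>Passing from \<open>m ^ t\<close> to \<open>n ^ t\<close> costs
      \<open>(2 * k) ^ t\<close>, because \<open>n \<le> 2 * k * m\<close>; the threshold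
      \<open>k\<close> makes the blocks nonempty.\<close>
    proof (rule exI[of _ "(2 * k) ^ t * N"], rule exI[of _ k], intro allI impI)
      fix n S assume n: "k \<le> n" and S: "S \<subseteq> {..<n} \<rightarrow>\<^sub>E {0, 1 :: nat}"
        and free: "\<forall>A\<subseteq>S. card A = s \<longrightarrow> (\<exists>x\<in>A. \<exists>y\<in>A. x \<noteq> y \<and> hamming_dist n x y \<noteq> 2 * t)"
      define m where "m = n div k"
      define Q where "Q = {..<n} \<rightarrow>\<^sub>E {0, 1 :: nat}"
      define W where "W = {..<k} \<rightarrow>\<^sub>E {..<m}"
      have m: "1 \<le> m" using n k by (simp add: m_def div_greater_zero_iff Suc_le_eq)
      have km: "k * m \<le> n" by (simp add: m_def)
      have "n < k * Suc m" using k by (simp add: m_def dividend_less_times_div)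
      also have "k * Suc m \<le> k * (2 * m)" using m by (intro mult_le_mono2) simp
      finally have nm: "n \<le> 2 * k * m" by (simp add: mult_ac)
      have finQ: "finite Q" unfolding Q_def by (rule finite_cube)
      have finW: "finite W" unfolding W_def by (intro finite_PiE) auto
      have sel: "selection m k f \<subseteq> {..<n}" if "f \<in> W" for f
        using that km by (intro selection_subset) (simp_all add: W_def)
      define F where "F y = {f\<in>W. flip (selection m k f) y \<in> S}" for y
      have dist: "hamming_dist n (flip (selection m k f) y) (flip (selection m k g) y) = 2 * card (diff_set f g)"
        if "y \<in> Q" "f \<in> W" "g \<in> W" for f g y
        using that sel hamming_dist_flip[of y n "selection m k f" "selection m k g"]
          card_selection_sym_diff[of f k m g] by (simp add: Q_def W_def)
      have small: "card (F y) \<le> N * m ^ (k - t)" if y: "y \<in> Q" for y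
      proof (rule N, goal_cases)
        case 1
        show ?case by (auto simp: F_def W_def)
      next
        case 2
        show ?case
        proof (intro allI impI, rule ccontr)
          fix A assume A: "A \<subseteq> F y" "card A = s"
            and "\<not> (\<exists>x\<in>A. \<exists>z\<in>A. x \<noteq> z \<and> card (diff_set x z) \<noteq> t)"
          then have eq: "card (diff_set f g) = t" if "f \<in> A" "g \<in> A" "f \<noteq> g" for f g
            using that by blast
          have AW: "f \<in> W" if "f \<in> A" for f using A that by (auto simp: F_def)
          define h where "h f = flip (selection m k f) y" for f
          have d: "hamming_dist n (h f) (h g) = 2 * t" if "f \<in> A" "g \<in> A" "f \<noteq> g" for f g
            using dist[OF y] AW eq that by (simp add: h_def)
          \<comment> \<open>Since \<open>t \<ge> 1\<close>, distinct words of \<open>A\<close> land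
            at positive distance, so the image still has \<open>s\<close> vertices.\<close>
          have inj: "inj_on h A"
          proof (rule inj_onI, rule ccontr)
            fix f g assume fg: "f \<in> A" "g \<in> A" "h f = h g" "f \<noteq> g"
            then have "hamming_dist n (h f) (h g) = 0" by (simp add: hamming_dist_def)
            then show False using d[of f g] fg t by simp
          qed
          have "h ` A \<subseteq> S" using A by (auto simp: F_def h_def)
          moreover have "card (h ` A) = s" using A inj by (simp add: card_image)
          ultimately have "\<exists>x\<in>h ` A. \<exists>y\<in>h ` A. x \<noteq> y \<and> hamming_dist n x y \<noteq> 2 * t"
            by (rule free[rule_format])
          then obtain f g where "f \<in> A" "g \<in> A" "h f \<noteq> h g" "hamming_dist n (h f) (h g) \<noteq> 2 * t"
            by (elim bexE imageE) auto
          then show False using d[of f g] by auto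
        qed
      qed
      \<comment> \<open>For fixed \<open>f\<close> the flip is an involution of the cube, so every
        vertex of \<open>S\<close> is reached from its own centre \<open>y\<close>.\<close>
      have "card S \<le> card {y\<in>Q. flip (selection m k f) y \<in> S}" if f: "f \<in> W" for f
      proof (rule card_inj_on_le[where f = "flip (selection m k f)"])
        show "inj_on (flip (selection m k f)) S"
          by (rule inj_on_inverseI) (rule flip_flip[OF subsetD[OF S] sel[OF f]])
        show "flip (selection m k f) ` S \<subseteq> {y\<in>Q. flip (selection m k f) y \<in> S}"
        proof
          fix z assume "z \<in> flip (selection m k f) ` S"
          then obtain x where x: "x \<in> S" "z = flip (selection m k f) x" by blast
          have "x \<in> Q" using subsetD[OF S x(1)] unfolding Q_def .
          then show "z \<in> {y\<in>Q. flip (selection m k f) y \<in> S}"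
            using x flip_flip[of x n] flip_in_cube[of x n] sel[OF f] by (simp add: Q_def)
        qed
      qed (use finQ in simp)
      then have "card W * card S \<le> (\<Sum>f\<in>W. card {y\<in>Q. flip (selection m k f) y \<in> S})"
        using sum_mono[of W "\<lambda>_. card S"] by simp
      \<comment> \<open>Double counting of the pairs \<open>(f, y)\<close> whose flip lies in
        \<open>S\<close>.\<close>
      also have "\<dots> = (\<Sum>y\<in>Q. card (F y))"
        unfolding F_def by (rule sum_multicount_gen[OF finW finQ]) simp
      also have "\<dots> \<le> card Q * (N * m ^ (k - t))"
        using sum_bounded_above[of Q "\<lambda>y. card (F y)"] small by simp
      finally have "m ^ k * card S \<le> 2 ^ n * (N * m ^ (k - t))"
        by (simp add: W_def Q_def card_PiE numeral_2_eq_2)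
      \<comment> \<open>Cancelling \<open>m ^ (k - t)\<close> leaves the saving of
        \<open>m ^ t\<close> over the trivial bound.\<close>
      also have "m ^ k = m ^ (k - t) * m ^ t" using k by (simp flip: power_add)
      finally have "m ^ (k - t) * (m ^ t * card S) \<le> m ^ (k - t) * (N * 2 ^ n)"
        by (simp add: mult_ac)
      then have key: "m ^ t * card S \<le> N * 2 ^ n" using m by simp
      have "n ^ t * card S \<le> (2 * k * m) ^ t * card S"
        using nm by (intro mult_right_mono power_mono) auto
      also have "\<dots> = (2 * k) ^ t * (m ^ t * card S)" by (simp add: power_mult_distrib mult_ac)
      also have "\<dots> \<le> (2 * k) ^ t * (N * 2 ^ n)" using key by (rule mult_le_mono2)
      finally show "n ^ t * card S \<le> (2 * k) ^ t * N * 2 ^ n" by (simp add: mult_ac)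
    qed
  qed

  \<comment> \<open>Lower bound: a large syndrome class of a BCH code\<close>
  have exists_large_code: "\<exists>C \<subseteq> {..<n} \<rightarrow>\<^sub>E {0, 1}. 2 ^ n \<le> (2 * (n + 1)) ^ t * card C \<and>
    (\<forall>x\<in>C. \<forall>y\<in>C. hamming_dist n x y \<noteq> 2 * t)" for n
  proof -
    obtain m where m: "0 < m" "n + 1 \<le> 2 ^ m" "2 ^ m \<le> 2 * (n + 1)"
      using exists_power_of_two_between by blast
    \<comment> \<open>The field with \<open>2 ^ m\<close> elements, realised as the fixed points of
      the iterated Frobenius map.\<close>
    define K where "K = {x :: bit alg_closure. x ^ (2 ^ m) = x}"
    have char: "CHAR(bit alg_closure) = 2" by (simp add: CHAR_bit)
    have cardK: "card K = 2 ^ m"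
      unfolding K_def using char m(1) by (rule card_frobenius_fixed_points)
    then have finK: "finite K" by (intro card_ge_0_finite) simp
    have K_power: "x ^ j \<in> K" if "x \<in> K" for x j
      using that by (simp add: K_def flip: power_mult) (metis mult.commute power_mult)
    have K_sum: "(\<Sum>i\<in>I. g i) \<in> K" if "\<And>i. i \<in> I \<Longrightarrow> g i \<in> K" for I :: "nat set" and g
      using that freshmans_dream_sum'[where 'a = "bit alg_closure" and m = "2 ^ m" and n = m and f = g and A = I]
      by (simp add: K_def)
    have "0 \<in> K" by (simp add: K_def)
    \<comment> \<open>The bound \<open>n + 1 \<le> 2 ^ m\<close> leaves room for distinct nonzero
      locators \<open>a i\<close>, one per coordinate.\<close>
    then have "card {..<n} \<le> card (K - {0})" using cardK finK m by simp
    then obtain a where a: "a ` {..<n} \<subseteq> K - {0}" "inj_on a {..<n}"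
      using card_le_inj[of "{..<n}" "K - {0}"] finK by auto
    have aK: "a i \<in> K" if "i < n" for i using a(1) that by auto
    \<comment> \<open>Only the \<open>t\<close> odd power sums are recorded, as squaring determines
      the even ones; so there are at most \<open>(2 ^ m) ^ t\<close> syndromes rather than
      \<open>(2 ^ m) ^ (2 * t)\<close>.\<close>
    define syn where "syn x = restrict (\<lambda>k. \<Sum>i | i < n \<and> x i = 1. a i ^ (2 * k - 1)) {1..t}" for x :: "nat \<Rightarrow> nat"
    define Q where "Q = {..<n} \<rightarrow>\<^sub>E {0, 1 :: nat}"
    have "\<exists>b\<in>{1..t} \<rightarrow>\<^sub>E K. card Q \<le> card ({1..t} \<rightarrow>\<^sub>E K) * card {x\<in>Q. syn x = b}"
    proof (rule pigeonhole_card)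
      show "finite Q" unfolding Q_def by (rule finite_cube)
      show "finite ({1..t} \<rightarrow>\<^sub>E K)" using finK by (intro finite_PiE) auto
      show "syn ` Q \<subseteq> {1..t} \<rightarrow>\<^sub>E K"
        unfolding syn_def by (auto intro!: K_sum K_power aK)
      show "{1..t} \<rightarrow>\<^sub>E K \<noteq> {}" using \<open>0 \<in> K\<close> by (auto simp: PiE_eq_empty_iff)
    qed
    then obtain b where b: "card Q \<le> card ({1..t} \<rightarrow>\<^sub>E K) * card {x\<in>Q. syn x = b}" by blast
    define C where "C = {x\<in>Q. syn x = b}"
    have "2 ^ n = card Q" by (simp add: Q_def card_PiE numeral_2_eq_2)
    also have "\<dots> \<le> (2 ^ m) ^ t * card C" using b by (simp add: card_PiE cardK C_def)
    also have "\<dots> \<le> (2 * (n + 1)) ^ t * card C" using m by (intro mult_right_mono power_mono) auto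
    finally have "2 ^ n \<le> (2 * (n + 1)) ^ t * card C" .
    moreover have "hamming_dist n x y \<noteq> 2 * t" if xy: "x \<in> C" "y \<in> C" for x y
    proof
      assume dist: "hamming_dist n x y = 2 * t"
      define I where "I = {i\<in>{..<n}. x i \<noteq> y i}"
      have inj: "inj_on a I" using a(2) by (rule inj_on_subset) (auto simp: I_def)
      have "card I = 2 * t" using dist by (simp add: hamming_dist_def I_def)
      then have cardI: "card (a ` I) = 2 * t" using inj by (simp add: card_image)
      \<comment> \<open>The locators of the differing coordinates are \<open>2 * t\<close> distinct
        nonzero elements. Equal syndromes will force all their odd power sums to vanish.\<close>
      have "\<exists>k\<in>{1..t}. (\<Sum>c\<in>a ` I. c ^ (2 * k - 1)) \<noteq> 0"
      proof (rule odd_power_sums_nonzero[OF char])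
        show "a ` I \<noteq> {}" using cardI t by auto
        show "0 \<notin> a ` I" using a(1) by (force simp: I_def)
      qed (use cardI in \<open>auto simp: I_def\<close>)
      then obtain k where k: "k \<in> {1..t}" "(\<Sum>i\<in>I. a i ^ (2 * k - 1)) \<noteq> 0"
        using inj by (auto simp: sum.reindex)
      define ones where "ones z = {i. i < n \<and> z i = 1}" for z :: "nat \<Rightarrow> nat"
      define g where "g i = a i ^ (2 * k - 1)" for i
      have two: "u + u = 0" for u :: "bit alg_closure"
      proof -
        have "of_nat 2 = (0 :: bit alg_closure)" by (metis char of_nat_CHAR)
        then show ?thesis by (metis mult_zero_left of_nat_numeral mult_2)
      qed
      have "syn x k = syn y k" using xy by (simp add: C_def)
      then have eq: "sum g (ones x) = sum g (ones y)" using k(1) by (simp add: syn_def ones_def g_def)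
      have fin: "finite (ones z)" for z by (simp add: ones_def)
      have "I = (ones x - ones y) \<union> (ones y - ones x)"
      proof -
        have "x i \<in> {0, 1}" "y i \<in> {0, 1}" if "i < n" for i
          using xy that by (auto simp: C_def Q_def)
        then show ?thesis unfolding I_def ones_def by fastforce
      qed
      then have "sum g I = sum g (ones x - ones y) + sum g (ones y - ones x)"
        using fin by (simp only:) (rule sum.union_disjoint; blast)
      \<comment> \<open>Adding the overlap twice changes nothing in characteristic 2 and completes
        both parts to the full supports.\<close>
      also have "\<dots> = sum g (ones x - ones y) + sum g (ones y - ones x) + (sum g (ones x \<inter> ones y) + sum g (ones x \<inter> ones y))"
        by (simp add: two)
      also have "\<dots> = (sum g (ones x \<inter> ones y) + sum g (ones x - ones y)) + (sum g (ones y \<inter> ones x) + sum g (ones y - ones x))"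
        by (simp add: algebra_simps Int_commute)
      also have "\<dots> = sum g (ones x) + sum g (ones y)"
        using fin by (simp flip: sum.Int_Diff)
      also have "\<dots> = 0" using eq two by simp
      finally show False using k(2) by (simp add: g_def)
    qed
    ultimately show ?thesis by (intro exI[of _ C]) (auto simp: C_def Q_def)
  qed

  \<comment> \<open>Transfer of both bounds to the clique-free number\<close>
  define \<alpha> where "\<alpha> n = clique_free_number s (with_proj (distance_graph (2 * t) n))" for n
  define good where "good n S \<longleftrightarrow> S \<subseteq> {..<n} \<rightarrow>\<^sub>E {0, 1 :: nat} \<and>
    (\<forall>A\<subseteq>S. card A = s \<longrightarrow> (\<exists>x\<in>A. \<exists>y\<in>A. x \<noteq> y \<and> hamming_dist n x y \<noteq> 2 * t))" for n S
  have good_iff: "S \<subseteq> verts (with_proj (distance_graph (2 * t) n)) \<and>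
    \<not> contains_complete s (with_proj (distance_graph (2 * t) n) \<restriction> S) \<longleftrightarrow> good n S" for n S
    using contains_complete_distance_graph_iff[of S n s "2 * t"]
    by (auto simp: good_def distance_graph_def)
  have \<alpha>: "\<alpha> n = Max {card S | S. good n S}" for n
    unfolding \<alpha>_def clique_free_number_def good_iff ..
  have fin: "finite (verts (with_proj (distance_graph (2 * t) n)))" for n
    using finite_cube by (simp add: distance_graph_def)
  have fin_ne: "finite {card S | S. good n S}" "{card S | S. good n S} \<noteq> {}" for n
    using clique_free_number_well_defined[OF fin[of n], of s] assms(1) unfolding good_iff by auto
  have \<alpha>_ge: "card S \<le> \<alpha> n" if "good n S" for n S
    unfolding \<alpha> using fin_ne(1) that by (intro Max_ge) auto
  have \<alpha>_attained: "\<exists>S. good n S \<and> \<alpha> n = card S" for n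
    using Max_in[OF fin_ne[of n]] unfolding \<alpha> by auto

  obtain c n\<^sub>0 where "\<forall>n\<ge>n\<^sub>0. \<forall>S \<subseteq> {..<n} \<rightarrow>\<^sub>E {0, 1}.
    (\<forall>A\<subseteq>S. card A = s \<longrightarrow> (\<exists>x\<in>A. \<exists>y\<in>A. x \<noteq> y \<and> hamming_dist n x y \<noteq> 2 * t)) \<longrightarrow>
    n ^ t * card S \<le> c * 2 ^ n"
    using clique_free_upper_bound by (elim exE) (rule that)
  then have c: "n ^ t * card S \<le> c * 2 ^ n" if "n\<^sub>0 \<le> n" "good n S" for n S
    using that by (simp add: good_def)
  have upper: "real (\<alpha> n) \<le> real c * (2 ^ n / real n ^ t)" if "n\<^sub>0 \<le> n" "1 \<le> n" for n
  proof -
    have "n ^ t * \<alpha> n \<le> c * 2 ^ n" using \<alpha>_attained[of n] c[OF that(1)] by auto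
    then have "real (n ^ t * \<alpha> n) \<le> real (c * 2 ^ n)" by (rule of_nat_mono)
    then show ?thesis using that(2) by (simp add: field_simps)
  qed
  have lower: "2 ^ n / real n ^ t \<le> 4 ^ t * real (\<alpha> n)" if "1 \<le> n" for n
  proof -
    obtain C where C: "C \<subseteq> {..<n} \<rightarrow>\<^sub>E {0, 1}" "2 ^ n \<le> (2 * (n + 1)) ^ t * card C"
      "\<forall>x\<in>C. \<forall>y\<in>C. hamming_dist n x y \<noteq> 2 * t"
      using exists_large_code[of n] by blast
    \<comment> \<open>As \<open>s \<ge> 2\<close>, a clique would contain two words of
      \<open>C\<close> at distance \<open>2 * t\<close>.\<close>
    have "\<exists>x\<in>A. \<exists>y\<in>A. x \<noteq> y \<and> hamming_dist n x y \<noteq> 2 * t" if A: "A \<subseteq> C" "card A = s" for A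
    proof -
      have "\<not> card A \<le> Suc 0" using A(2) assms(1) by simp
      moreover have "finite A" using A(2) assms(1) by (intro card_ge_0_finite) simp
      ultimately obtain x y where "x \<in> A" "y \<in> A" "x \<noteq> y" by (auto simp: card_le_Suc0_iff_eq)
      then show ?thesis using C(3) A(1) by blast
    qed
    then have "good n C" using C(1) by (simp add: good_def)
    have "2 ^ n \<le> (2 * (n + 1)) ^ t * card C" by (rule C(2))
    also have "\<dots> \<le> (4 * n) ^ t * \<alpha> n"
    proof (rule mult_le_mono)
      \<comment> \<open>For \<open>n \<ge> 1\<close> one has \<open>2 * (n + 1) \<le> 4 * n\<close>,
        the source of the constant \<open>4 ^ t\<close>.\<close>
      show "(2 * (n + 1)) ^ t \<le> (4 * n) ^ t" using that by (intro power_mono) simp_all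
    qed (rule \<alpha>_ge[OF \<open>good n C\<close>])
    finally have "real (2 ^ n) \<le> real ((4 * n) ^ t * \<alpha> n)" by (rule of_nat_mono)
    then show ?thesis using that by (simp add: field_simps power_mult_distrib)
  qed
  have "(\<lambda>n. real (\<alpha> n)) \<in> O(\<lambda>n. 2 ^ n / real n ^ t)"
  proof (rule bigoI, rule eventually_sequentiallyI)
    fix n assume "max n\<^sub>0 1 \<le> n"
    then show "norm (real (\<alpha> n)) \<le> real c * norm (2 ^ n / real n ^ t)"
      using upper[of n] by simp
  qed
  moreover have "(\<lambda>n. 2 ^ n / real n ^ t) \<in> O(\<lambda>n. real (\<alpha> n))"
  proof (rule bigoI, rule eventually_sequentiallyI)
    fix n :: nat assume "1 \<le> n"
    then show "norm (2 ^ n / real n ^ t) \<le> 4 ^ t * norm (real (\<alpha> n))"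
      using lower[of n] by simp
  qed
  ultimately show ?thesis unfolding \<alpha>_def by (simp add: bigtheta_def bigomega_iff_bigo)
qed

end
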